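(* The asymptotic growth constant for the number of dimer-monomers on the three-dimensional Sierpinski gasket $SG_3(n)$, $$z_{SG_3}=\lim_{n\to\infty}\frac{\ln N_{DM}(SG_3(n))}{v(SG_3(n))},$$ is $z_{SG_3}=0.781151467411\ldots$ (i.e. its decimal expansion begins with the digits shown).
   Context: A dimer-monomer configuration on a finite graph $G$ is a placement of dimers on edges such that each vertex is covered by at most one dimer (i.e. a matching of $G$, not necessarily perfect, possibly empty). $N_{DM}(G)$ is the number of such configurations, and $v(G)$ is the number of vertices of $G$. The $d$-dimensional Sierpinski gasket graph $SG_d(n)$, with $d+1$ distinguished "outmost" vertices labelled $1,\dots,d+1$, is defined recursively. $SG_d(0)$ is the complete graph on $d+1$ vertices, all of which are outmost. $SG_d(n+1)$ is obtained from $d+1$ disjoint copies of $SG_d(n)$, labelled $1,\dots,d+1$, by identifying, for each pair $l\neq m$, the outmost vertex $m$ of copy $l$ with the outmost vertex $l$ of copy $m$; the outmost vertex $l$ of $SG_d(n+1)$ is the outmost vertex $l$ of copy $l$. One has $v(SG_d(n))=\frac{d+1}{2}[(d+1)^n+1]$. Here $d=3$. *)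

theory Defs
  imports Complex_Main
begin

text \<open>A graph is a pair of a vertex set and a set of edges, an edge being the set of its two
  end points.\<close>

type_synonym 'a graph = "'a set \<times> 'a set set"

definition verts :: "'a graph \<Rightarrow> 'a set" where
  "verts G = fst G"

definition edges :: "'a graph \<Rightarrow> 'a set set" where
  "edges G = snd G"

definition dimer_monomer :: "'a graph \<Rightarrow> 'a set set \<Rightarrow> bool" where
  "dimer_monomer G M \<longleftrightarrow>
     M \<subseteq> edges G \<and> (\<forall>v\<in>verts G. \<forall>e\<in>M. \<forall>e'\<in>M. v \<in> e \<and> v \<in> e' \<longrightarrow> e = e')"

definition N_DM :: "'a graph \<Rightarrow> nat" where
  "N_DM G = card {M. dimer_monomer G M}"

text \<open>Vertices of the Sierpinski gasket graph are words over the labels \<open>1..d+1\<close>. The vertex \<open>w\<close>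
  of copy \<open>l\<close> is \<open>l # w\<close>, except that the two words \<open>l # outmost n m\<close> and \<open>m # outmost n l\<close>,
  which are to be identified, are both represented by the one with the smaller first letter.
  Thus \<open>glue n l\<close> maps copy \<open>l\<close> of stage \<open>n\<close> into stage \<open>n + 1\<close>; the lemma \<open>glue_eq_iff\<close>
  shows that it performs exactly the prescribed identifications.\<close>

fun outmost :: "nat \<Rightarrow> nat \<Rightarrow> nat list" where
  "outmost 0 l = [l]"
| "outmost (Suc n) l = l # outmost n l"

definition glue :: "nat \<Rightarrow> nat \<Rightarrow> nat list \<Rightarrow> nat list" where
  "glue n l w =
     (if last w < l \<and> w = outmost n (last w) then last w # outmost n l else l # w)"

fun sierpinski :: "nat \<Rightarrow> nat \<Rightarrow> nat list graph" where
  "sierpinski d 0 =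
     (outmost 0 ` {1..d+1},
      {{outmost 0 i, outmost 0 j} | i j. i \<in> {1..d+1} \<and> j \<in> {1..d+1} \<and> i \<noteq> j})"
| "sierpinski d (Suc n) =
     (\<Union>l\<in>{1..d+1}. glue n l ` verts (sierpinski d n),
      \<Union>l\<in>{1..d+1}. (\<lambda>e. glue n l ` e) ` edges (sierpinski d n))"

lemma last_outmost [simp]: "last (outmost n l) = l"
proof (induction n)
  case (Suc n)
  have "outmost n l \<noteq> []" by (cases n) auto
  with Suc show ?case by simp
qed simp

lemma outmost_inject [simp]: "outmost n l = outmost n m \<longleftrightarrow> l = m"
  by (metis last_outmost)

lemma glue_outmost: "glue n l (outmost n l) = outmost (Suc n) l"
  by (simp add: glue_def)

lemma glue_eq_iff:
  "glue n l u = glue n m v \<longleftrightarrow>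
     l = m \<and> u = v \<or> l \<noteq> m \<and> u = outmost n m \<and> v = outmost n l"
proof
  assume "glue n l u = glue n m v"
  then show "l = m \<and> u = v \<or> l \<noteq> m \<and> u = outmost n m \<and> v = outmost n l"
    by (auto simp: glue_def split: if_splits)
next
  assume "l = m \<and> u = v \<or> l \<noteq> m \<and> u = outmost n m \<and> v = outmost n l"
  then show "glue n l u = glue n m v"
    by (auto simp: glue_def)
qed

end

theory Submission
  imports Defs "HOL-Library.FuncSet"
begin

text \<open>Let \<open>a\<^sub>n k\<close> be the number of dimer-monomer configurations on \<open>SG\<^sub>3(n)\<close> that cover exactly \<open>k\<close>
  prescribed outmost vertices. Restricting a configuration to the four copies shows that
  \<open>a\<^sub>n\<^sub>+\<^sub>1 k\<close> is a sum of products of four values of \<open>a\<^sub>n\<close>, one term for each way of assigning the six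
  glued vertices to one of the two copies that share it or to none. Passing from \<open>k\<close> to \<open>k + 1\<close>
  raises one index in every term, so bounds \<open>\<alpha> \<le> a\<^sub>n (k + 1) / a\<^sub>n k \<le> \<beta>\<close> are inherited by all later
  stages. If these ratios all were \<open>\<lambda>\<close>, the sum for \<open>k = 0\<close> would be \<open>(1 + 2\<lambda>)\<^sup>6 (a\<^sub>n 0)\<^sup>4\<close>; hence
  \<open>z = (ln (a\<^sub>n 0) + 2 ln (1 + 2\<lambda>)) / (2 \<cdot> 4\<^sup>n)\<close> with some \<open>\<lambda>\<close> between \<open>\<alpha>\<close> and \<open>\<beta>\<close>. At stage 4 the
  ratios already agree to 15 digits.\<close>

section \<open>The gasket graph\<close>

definition labels :: "nat \<Rightarrow> nat set" where
  "labels d = {1..d + 1}"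

lemma finite_labels [simp]: "finite (labels d)"
  by (simp add: labels_def)

abbreviation sverts :: "nat \<Rightarrow> nat \<Rightarrow> nat list set" where
  "sverts d n \<equiv> verts (sierpinski d n)"

abbreviation sedges :: "nat \<Rightarrow> nat \<Rightarrow> nat list set set" where
  "sedges d n \<equiv> edges (sierpinski d n)"

declare sierpinski.simps [simp del]

lemma sverts_0: "sverts d 0 = outmost 0 ` labels d"
  by (simp add: verts_def sierpinski.simps labels_def)

lemma sverts_Suc: "sverts d (Suc n) = (\<Union>l\<in>labels d. glue n l ` sverts d n)"
  by (simp add: verts_def sierpinski.simps labels_def)

lemma sedges_0:
  "sedges d 0 = {{outmost 0 i, outmost 0 j} | i j. i \<in> labels d \<and> j \<in> labels d \<and> i \<noteq> j}"
  by (simp add: edges_def sierpinski.simps labels_def)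

lemma sedges_Suc: "sedges d (Suc n) = (\<Union>l\<in>labels d. image (glue n l) ` sedges d n)"
  by (simp add: edges_def sierpinski.simps labels_def)

lemma glue_inj: "inj_on (glue n l) A"
  by (simp add: inj_on_def glue_eq_iff)

lemma outmost_in_sverts: "i \<in> labels d \<Longrightarrow> outmost n i \<in> sverts d n"
proof (induction n)
  case 0
  then show ?case by (simp add: sverts_0)
next
  case (Suc n)
  then have "glue n i (outmost n i) \<in> sverts d (Suc n)"
    by (auto simp: sverts_Suc)
  then show ?case by (simp only: glue_outmost)
qed

lemma finite_sverts: "finite (sverts d n)"
  by (induction n) (auto simp: sverts_0 sverts_Suc)

lemma sedges_subset: "sedges d n \<subseteq> {e. e \<subseteq> sverts d n \<and> card e = 2}"
proof (induction n)
  case 0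
  then show ?case by (auto simp: sedges_0 sverts_0)
next
  case (Suc n)
  then show ?case
    by (auto simp: sedges_Suc sverts_Suc card_image glue_inj)
qed

lemma finite_sedges: "finite (sedges d n)"
  by (rule finite_subset[of _ "Pow (sverts d n)"]) (use sedges_subset finite_sverts in auto)

text \<open>The definition tests only vertices of the graph; edges lie inside the vertex set, so
  nothing is lost by asking that distinct edges be disjoint.\<close>

lemma dimer_monomer_iff:
  "dimer_monomer (sierpinski d n) M \<longleftrightarrow> M \<subseteq> sedges d n \<and> pairwise disjnt M"
  using sedges_subset[of d n]
  by (fastforce simp: dimer_monomer_def pairwise_def disjnt_iff)

text \<open>Each glued vertex is counted in the copy with the smaller label, so copy \<open>l\<close> loses \<open>l - 1\<close>
  vertices.\<close>

lemma card_sverts_Suc: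
  "card (sverts d (Suc n)) = (\<Sum>l\<in>labels d. card (sverts d n) - (l - 1))"
proof -
  define own where "own l = sverts d n - outmost n ` {1..<l}" for l
  have "(\<Union>l\<in>labels d. glue n l ` sverts d n) = (\<Union>l\<in>labels d. glue n l ` own l)"
  proof (intro equalityI subsetI)
    fix v assume "v \<in> (\<Union>l\<in>labels d. glue n l ` sverts d n)"
    then obtain l w where l: "l \<in> labels d" and w: "w \<in> sverts d n" and v: "v = glue n l w"
      by blast
    show "v \<in> (\<Union>l\<in>labels d. glue n l ` own l)"
    proof (cases "w \<in> own l")
      case True
      with l v show ?thesis by blast
    next
      case False
      then obtain m where m: "m \<in> {1..<l}" "w = outmost n m"
        using w by (auto simp: own_def)
      have "v = glue n m (outmost n l)"
        using m by (simp add: v glue_eq_iff)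
      moreover have "outmost n l \<in> own m"
        using m l outmost_in_sverts[of l d n] by (auto simp: own_def)
      moreover have "m \<in> labels d"
        using m l by (auto simp: labels_def)
      ultimately show ?thesis by blast
    qed
  qed (auto simp: own_def)
  then have "card (sverts d (Suc n)) = card (\<Union>l\<in>labels d. glue n l ` own l)"
    by (simp add: sverts_Suc)
  also have "\<dots> = (\<Sum>l\<in>labels d. card (glue n l ` own l))"
  proof (rule card_UN_disjoint)
    have "glue n l ` own l \<inter> glue n m ` own m = {}" if "l < m" "l \<in> labels d" for l m
      using that by (auto simp: own_def glue_eq_iff labels_def)
    then show "\<forall>l\<in>labels d. \<forall>m\<in>labels d. l \<noteq> m \<longrightarrow> glue n l ` own l \<inter> glue n m ` own m = {}"
      by (metis Int_commute linorder_neqE_nat)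
  qed (auto simp: own_def finite_sverts)
  also have "\<dots> = (\<Sum>l\<in>labels d. card (sverts d n) - (l - 1))"
  proof (rule sum.cong)
    fix l assume "l \<in> labels d"
    then have "outmost n ` {1..<l} \<subseteq> sverts d n"
      by (auto simp: labels_def intro!: outmost_in_sverts)
    moreover have "card (outmost n ` {1..<l}) = l - 1"
      by (subst card_image) (auto simp: inj_on_def)
    ultimately show "card (glue n l ` own l) = card (sverts d n) - (l - 1)"
      by (simp add: card_image glue_inj own_def card_Diff_subset)
  qed simp
  finally show ?thesis .
qed

text \<open>With \<open>c\<close> vertices per copy the next stage has
  \<open>4 * c - (0 + 1 + 2 + 3)\<close>, and \<open>c = 2 * (4 ^ n + 1)\<close> solves this
  recursion. As \<open>c \<ge> 4\<close>, the truncated subtractions are exact.\<close>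

lemma card_sverts_3: "card (sverts 3 n) = 2 * (4 ^ n + 1)"
proof (induction n)
  case 0
  show ?case by (simp add: sverts_0 labels_def card_image inj_on_def)
next
  case (Suc n)
  have "labels 3 = {1, 2, 3, 4}" by (auto simp: labels_def)
  with Suc show ?case by (simp add: card_sverts_Suc)
qed

section \<open>Gluing dimer-monomer configurations\<close>

definition covered :: "nat \<Rightarrow> nat \<Rightarrow> nat list set set \<Rightarrow> nat set" where
  "covered d n M = {i \<in> labels d. outmost n i \<in> \<Union>M}"

text \<open>Copies meet only in outmost vertices, so the set of covered ones is all that gluing has
  to know about a configuration.\<close>

definition matchings :: "nat \<Rightarrow> nat \<Rightarrow> nat set \<Rightarrow> nat list set set set" where
  "matchings d n S = {M. dimer_monomer (sierpinski d n) M \<and> covered d n M = S}"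

lemma finite_matchings: "finite (matchings d n S)"
  by (rule finite_subset[of _ "Pow (sedges d n)"])
    (auto simp: matchings_def dimer_monomer_def finite_sedges)

lemma N_DM_eq_sum: "N_DM (sierpinski d n) = (\<Sum>S\<in>Pow (labels d). card (matchings d n S))"
proof -
  have "{M. dimer_monomer (sierpinski d n) M} = (\<Union>S\<in>Pow (labels d). matchings d n S)"
  proof -
    have "covered d n M \<in> Pow (labels d)" for M
      unfolding covered_def by blast
    then show ?thesis
      unfolding matchings_def by blast
  qed
  also have "card \<dots> = (\<Sum>S\<in>Pow (labels d). card (matchings d n S))"
  proof (rule card_UN_disjoint)
    show "\<forall>S\<in>Pow (labels d). \<forall>T\<in>Pow (labels d). S \<noteq> T \<longrightarrow> matchings d n S \<inter> matchings d n T = {}"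
      unfolding matchings_def by blast
  qed (simp_all add: finite_matchings)
  finally show ?thesis
    unfolding N_DM_def .
qed

definition join :: "nat \<Rightarrow> nat \<Rightarrow> (nat \<Rightarrow> nat list set set) \<Rightarrow> nat list set set" where
  "join d n f = (\<Union>l\<in>labels d. image (glue n l) ` f l)"

text \<open>The diagonal of an interface relation records which corners of the big graph are covered;
  antisymmetry says that no glued vertex is covered from both sides.\<close>

definition interfaces :: "'b set \<Rightarrow> 'b set \<Rightarrow> ('b \<times> 'b) set set" where
  "interfaces V S = {R. R \<subseteq> V \<times> V \<and> antisym R \<and> {l. (l, l) \<in> R} = S}"

text \<open>Distinct copies share a single vertex, so an edge, having two end points, lies in only
  one of them.\<close>

lemma glue_image_eq_iff:
  assumes "card e = 2"
  shows "glue n l ` e = glue n m ` e' \<longleftrightarrow> l = m \<and> e = e'"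
proof (cases "l = m")
  case True
  then show ?thesis
    by (simp add: inj_image_eq_iff glue_inj)
next
  case False
  have "e \<subseteq> {outmost n m}" if "glue n l ` e = glue n m ` e'"
  proof
    fix v assume "v \<in> e"
    then have "glue n l v \<in> glue n m ` e'"
      using that by blast
    then show "v \<in> {outmost n m}"
      using False by (auto simp: glue_eq_iff)
  qed
  then have "glue n l ` e \<noteq> glue n m ` e'"
    using assms card_mono[of "{outmost n m}" e] by fastforce
  with False show ?thesis by blast
qed

lemma disjnt_glue_image_iff:
  "disjnt (glue n l ` e) (glue n m ` e') \<longleftrightarrow>
    (if l = m then disjnt e e' else \<not> (outmost n m \<in> e \<and> outmost n l \<in> e'))"
  by (auto simp: disjnt_iff glue_eq_iff)

text \<open>An edge of the large graph determines its copy and its preimage there, so every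
  component can be read off from the join; functions in \<open>PiE\<close> agree outside
  \<open>labels d\<close> anyway.\<close>

lemma join_inj:
  assumes "f \<in> PiE (labels d) (\<lambda>_. Pow (sedges d n))" "g \<in> PiE (labels d) (\<lambda>_. Pow (sedges d n))"
    and "join d n f = join d n g"
  shows "f = g"
proof -
  have sub: "f l \<subseteq> g l"
    if "f \<in> PiE (labels d) (\<lambda>_. Pow (sedges d n))" "join d n f = join d n g" "l \<in> labels d" for f g l
  proof
    fix e assume e: "e \<in> f l"
    then have "card e = 2"
      using that(1,3) sedges_subset[of d n] by (auto simp: PiE_iff)
    moreover have "glue n l ` e \<in> join d n g"
      using e that(3) unfolding that(2)[symmetric] by (auto simp: join_def)
    ultimately show "e \<in> g l"
      by (auto simp: join_def glue_image_eq_iff)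
  qed
  show ?thesis
    using sub[OF assms(1,3)] sub[OF assms(2) assms(3)[symmetric]]
    by (intro PiE_ext[OF assms(1,2)]) blast
qed

text \<open>The outmost vertex \<open>i\<close> of the large graph belongs to copy \<open>i\<close>
  alone, being glued to nothing.\<close>

lemma covered_join:
  "i \<in> covered d (Suc n) (join d n f) \<longleftrightarrow> i \<in> labels d \<and> i \<in> covered d n (f i)"
proof -
  have "glue n i (outmost n i) \<in> \<Union>(join d n f) \<longleftrightarrow> outmost n i \<in> \<Union>(f i)" if "i \<in> labels d"
  proof -
    have "glue n i (outmost n i) \<in> glue n l ` e \<longleftrightarrow> l = i \<and> outmost n i \<in> e" for l e
      by (auto simp: glue_eq_iff)
    with that show ?thesis by (auto simp: join_def)
  qed
  then show ?thesis
    by (auto simp only: covered_def glue_outmost mem_Collect_eq)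
qed

text \<open>A pair \<open>(l, m)\<close> of the relation says that copy \<open>l\<close> covers the
  vertex it shares with copy \<open>m\<close>. Edges from different copies can clash only at such a
  vertex, and then \<open>(m, l)\<close> is in the relation too.\<close>

lemma disjnt_join_iff:
  assumes "f \<in> PiE (labels d) (\<lambda>_. Pow (sedges d n))"
  shows "pairwise disjnt (join d n f) \<longleftrightarrow> (\<forall>l\<in>labels d. pairwise disjnt (f l)) \<and>
    antisym {(l, m). l \<in> labels d \<and> m \<in> covered d n (f l)}"
proof -
  have card2: "card e = 2" if "l \<in> labels d" "e \<in> f l" for l e
    using assms that sedges_subset[of d n] by (auto simp: PiE_iff)
  have "pairwise disjnt (join d n f) \<longleftrightarrow>
    (\<forall>l\<in>labels d. \<forall>e\<in>f l. \<forall>m\<in>labels d. \<forall>e'\<in>f m. glue n l ` e \<noteq> glue n m ` e' \<longrightarrow>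
       disjnt (glue n l ` e) (glue n m ` e'))"
    by (simp add: pairwise_def join_def)
  also have "\<dots> \<longleftrightarrow> (\<forall>l\<in>labels d. \<forall>e\<in>f l. \<forall>m\<in>labels d. \<forall>e'\<in>f m. \<not> (l = m \<and> e = e') \<longrightarrow>
       (if l = m then disjnt e e' else \<not> (outmost n m \<in> e \<and> outmost n l \<in> e')))"
    by (intro ball_cong refl) (simp only: glue_image_eq_iff[OF card2] disjnt_glue_image_iff)
  also have "\<dots> \<longleftrightarrow> (\<forall>l\<in>labels d. pairwise disjnt (f l)) \<and>
    antisym {(l, m). l \<in> labels d \<and> m \<in> covered d n (f l)}"
    (is "?L \<longleftrightarrow> ?disj \<and> ?asym")
  proof (intro iffI conjI)
    assume L: ?L
    show ?disj
      using L unfolding pairwise_def by (metis (full_types))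
    show ?asym
    proof (rule antisymI)
      fix l m
      assume "(l, m) \<in> {(l, m). l \<in> labels d \<and> m \<in> covered d n (f l)}"
        and "(m, l) \<in> {(l, m). l \<in> labels d \<and> m \<in> covered d n (f l)}"
      then obtain e e' where "l \<in> labels d" "m \<in> labels d" "e \<in> f l" "e' \<in> f m"
        "outmost n m \<in> e" "outmost n l \<in> e'"
        unfolding covered_def by blast
      with L show "l = m" by metis
    qed
  next
    assume R: "?disj \<and> ?asym"
    show ?L
    proof (intro ballI impI)
      fix l e m e' assume lm: "l \<in> labels d" "e \<in> f l" "m \<in> labels d" "e' \<in> f m"
        and ne: "\<not> (l = m \<and> e = e')"
      show "if l = m then disjnt e e' else \<not> (outmost n m \<in> e \<and> outmost n l \<in> e')"
      proof (cases "l = m")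
        case True
        with R lm ne show ?thesis by (simp add: pairwise_def)
      next
        case False
        moreover have "m \<in> covered d n (f l)" "l \<in> covered d n (f m)"
          if "outmost n m \<in> e" "outmost n l \<in> e'"
          using that lm unfolding covered_def by blast+
        ultimately show ?thesis
          using R lm unfolding antisym_def by auto
      qed
    qed
  qed
  finally show ?thesis .
qed

lemma card_matchings_Suc:
  "card (matchings d (Suc n) S) =
    (\<Sum>R\<in>interfaces (labels d) S. \<Prod>l\<in>labels d. card (matchings d n (R `` {l})))"
proof -
  define F where "F R = PiE (labels d) (\<lambda>l. matchings d n (R `` {l}))" for R
  define U where "U = PiE (labels d) (\<lambda>_. Pow (sedges d n))"
  define rel where "rel f = {(l, m). l \<in> labels d \<and> m \<in> covered d n (f l)}" for f
  \<comment> \<open>The relation is a function of the family \<open>f\<close>, so the sets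
    \<open>F R\<close> for different \<open>R\<close> are disjoint.\<close>
  have F_iff: "f \<in> F R \<longleftrightarrow> f \<in> U \<and> (\<forall>l\<in>labels d. pairwise disjnt (f l)) \<and> rel f = R"
    if "R \<in> interfaces (labels d) S" for f R
  proof -
    have R: "R \<subseteq> labels d \<times> labels d"
      using that by (simp add: interfaces_def)
    have "rel f = R \<longleftrightarrow> (\<forall>l\<in>labels d. covered d n (f l) = R `` {l})"
      using R unfolding rel_def by blast
    then show ?thesis
      by (auto simp: F_def U_def PiE_iff matchings_def dimer_monomer_iff)
  qed
  have "matchings d (Suc n) S = join d n ` (\<Union>R\<in>interfaces (labels d) S. F R)"
  proof (intro equalityI subsetI)
    fix M assume M: "M \<in> matchings d (Suc n) S"
    \<comment> \<open>The decomposition of \<open>M\<close>: pull its edges back to each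
      copy.\<close>
    define f where "f = (\<lambda>l\<in>labels d. {e \<in> sedges d n. glue n l ` e \<in> M})"
    have "f \<in> U" by (auto simp: f_def U_def)
    have "M = join d n f"
    proof
      have "M \<subseteq> (\<Union>l\<in>labels d. image (glue n l) ` sedges d n)"
        using M by (simp add: matchings_def dimer_monomer_iff sedges_Suc)
      then show "M \<subseteq> join d n f"
        unfolding join_def f_def by fastforce
    qed (auto simp: join_def f_def)
    have disj: "(\<forall>l\<in>labels d. pairwise disjnt (f l)) \<and> antisym (rel f)"
      using M disjnt_join_iff[of f d n] \<open>f \<in> U\<close> \<open>M = join d n f\<close>
      by (simp add: matchings_def dimer_monomer_iff U_def rel_def)
    moreover have "{l. (l, l) \<in> rel f} = S"
      using M covered_join[of _ d n f] \<open>M = join d n f\<close>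
      by (auto simp: matchings_def rel_def)
    ultimately have R: "rel f \<in> interfaces (labels d) S"
      by (auto simp: interfaces_def rel_def covered_def)
    then have "f \<in> F (rel f)"
      using F_iff \<open>f \<in> U\<close> disj by blast
    with R show "M \<in> join d n ` (\<Union>R\<in>interfaces (labels d) S. F R)"
      using \<open>M = join d n f\<close> by blast
  next
    fix M assume "M \<in> join d n ` (\<Union>R\<in>interfaces (labels d) S. F R)"
    then obtain R f where R: "R \<in> interfaces (labels d) S" and f: "f \<in> F R" "M = join d n f"
      by blast
    then have U: "f \<in> U" and rel: "rel f = R" and disj: "\<forall>l\<in>labels d. pairwise disjnt (f l)"
      using F_iff by blast+
    have "M \<subseteq> sedges d (Suc n)"
      using U by (fastforce simp: f(2) join_def sedges_Suc U_def PiE_iff)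
    moreover have "pairwise disjnt M"
      using disjnt_join_iff[of f d n] U R disj rel
      by (simp add: f(2) U_def rel_def interfaces_def)
    moreover have "covered d (Suc n) M = S"
      using R by (auto simp: f(2) covered_join interfaces_def simp flip: rel) (auto simp: rel_def)
    ultimately show "M \<in> matchings d (Suc n) S"
      by (simp add: matchings_def dimer_monomer_iff)
  qed
  moreover have "inj_on (join d n) (\<Union>R\<in>interfaces (labels d) S. F R)"
    using join_inj F_iff by (auto simp: inj_on_def U_def)
  ultimately have "card (matchings d (Suc n) S) = card (\<Union>R\<in>interfaces (labels d) S. F R)"
    by (simp add: card_image)
  also have "\<dots> = (\<Sum>R\<in>interfaces (labels d) S. card (F R))"
  proof (rule card_UN_disjoint)
    show "finite (interfaces (labels d) S)"
      by (rule finite_subset[of _ "Pow (labels d \<times> labels d)"]) (auto simp: interfaces_def)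
  qed (auto simp: F_iff, auto simp: F_def finite_matchings intro!: finite_PiE)
  also have "\<dots> = (\<Sum>R\<in>interfaces (labels d) S. \<Prod>l\<in>labels d. card (matchings d n (R `` {l})))"
    by (simp add: F_def card_PiE)
  finally show ?thesis .
qed

section \<open>The recursion for the numbers of configurations\<close>

lemma exists_bij_image:
  assumes "finite V" "S \<subseteq> V" "T \<subseteq> V" "card S = card T"
  obtains p where "bij p" "p ` V = V" "p ` S = T"
proof -
  have "finite S" "finite T"
    using assms finite_subset by auto
  then obtain f where f: "bij_betw f S T"
    using assms(4) finite_same_card_bij by blast
  have "card (V - S) = card (V - T)"
    using assms \<open>finite S\<close> \<open>finite T\<close> by (simp add: card_Diff_subset)
  then obtain g where g: "bij_betw g (V - S) (V - T)"
    using assms(1) finite_same_card_bij by blast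
  define h where "h x = (if x \<in> S then f x else g x)" for x
  have h: "bij_betw h V V"
    using bij_betw_disjoint_Un[OF f g] assms(2,3)
    unfolding h_def by (simp add: Un_absorb1 Un_Diff_cancel)
  \<comment> \<open>Extending by the identity outside \<open>V\<close> gives a bijection of the
    whole type, so relations can be transported without restricting them to
    \<open>V\<close>.\<close>
  have "bij_betw (\<lambda>x. if x \<in> V then h x else id x) (V \<union> - V) (V \<union> - V)"
    by (rule bij_betw_disjoint_Un[OF h]) (auto simp: bij_betw_def)
  then have bij: "bij (\<lambda>x. if x \<in> V then h x else x)"
    by (simp add: id_def cong: if_cong)
  have "h ` S = T"
    using f unfolding bij_betw_def h_def by auto
  show thesis
  proof (rule that[OF bij])
    show "(\<lambda>x. if x \<in> V then h x else x) ` V = V"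
      using h by (auto simp: bij_betw_def)
    show "(\<lambda>x. if x \<in> V then h x else x) ` S = T"
      using \<open>h ` S = T\<close> assms(2) by auto
  qed
qed

text \<open>A permutation of \<open>V\<close> taking \<open>S\<close> to \<open>T\<close> carries
  interface relations to interface relations and permutes their out-degrees. This is why the counts
  depend only on the number of covered outmost vertices.\<close>

lemma sum_interfaces_eq:
  assumes "finite V" "S \<subseteq> V" "T \<subseteq> V" "card S = card T"
  shows "(\<Sum>R\<in>interfaces V S. \<Prod>l\<in>V. a (card (R `` {l}))) =
    (\<Sum>R\<in>interfaces V T. \<Prod>l\<in>V. (a (card (R `` {l})) :: 'a::comm_semiring_1))"
proof -
  obtain p where p: "bij p" "p ` V = V" "p ` S = T"
    using exists_bij_image[OF assms] by blast
  define q where "q = inv p"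
  have q: "q (p x) = x" "p (q x) = x" for x
    using p(1) by (auto simp: q_def bij_is_inj bij_is_surj surj_f_inv_f)
  have V: "p x \<in> V \<longleftrightarrow> x \<in> V" "q x \<in> V \<longleftrightarrow> x \<in> V" for x
    using p q by (metis image_iff)+
  have S: "p x \<in> T \<longleftrightarrow> x \<in> S" "q x \<in> S \<longleftrightarrow> x \<in> T" for x
    using p q by (metis image_iff)+
  define P where "P f R = {(x, y). (f x, f y) \<in> R}" for f :: "'b \<Rightarrow> 'b" and R
  have P_in: "P f R \<in> interfaces V B"
    if R: "R \<in> interfaces V A" and f: "inj f" "\<And>x. f x \<in> V \<longleftrightarrow> x \<in> V" "\<And>x. f x \<in> A \<longleftrightarrow> x \<in> B"
    for f R A B
  proof -
    have "antisym (P f R)"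
      using R injD[OF f(1)] unfolding interfaces_def antisym_def P_def by blast
    moreover have "(x, y) \<in> V \<times> V" if "(x, y) \<in> P f R" for x y
      using R f(2) that unfolding interfaces_def P_def by blast
    moreover have "(x, x) \<in> P f R \<longleftrightarrow> x \<in> B" for x
      using R f(3) unfolding interfaces_def P_def by blast
    ultimately show ?thesis
      unfolding interfaces_def by auto
  qed
  show ?thesis
  proof (rule sum.reindex_bij_witness[where i = "P p" and j = "P q"])
    fix R assume R: "R \<in> interfaces V S"
    show "P p (P q R) = R"
      by (simp add: P_def q)
    have "inj q"
      using q(2) by (metis injI)
    then show "P q R \<in> interfaces V T"
      by (rule P_in[OF R]) (simp_all add: V S)
    \<comment> \<open>The element \<open>p l\<close> has the same out-degree in the transported
      relation as \<open>l\<close> in \<open>R\<close>; reindexing the product by \<open>p\<close>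
      then finishes.\<close>
    have "P q R `` {p l} = p ` (R `` {l})" for l
    proof (intro equalityI subsetI)
      fix y assume "y \<in> P q R `` {p l}"
      then have "q y \<in> R `` {l}" "y = p (q y)"
        by (auto simp: P_def q)
      then show "y \<in> p ` (R `` {l})"
        by blast
    qed (auto simp: P_def q)
    then have "card (P q R `` {p l}) = card (R `` {l})" for l
      using p(1) by (simp add: card_image bij_is_inj inj_on_subset[OF _ subset_UNIV])
    then show "(\<Prod>l\<in>V. a (card (P q R `` {l}))) = (\<Prod>l\<in>V. a (card (R `` {l})))"
      using prod.reindex[of p V "\<lambda>l. a (card (P q R `` {l}))"] p
      by (simp add: bij_is_inj inj_on_subset[OF _ subset_UNIV])
  next
    fix R assume R: "R \<in> interfaces V T"
    show "P q (P p R) = R"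
      by (simp add: P_def q)
    show "P p R \<in> interfaces V S"
      using p(1) by (intro P_in[OF R]) (simp_all add: V S bij_is_inj)
  qed
qed

section \<open>Interface sums as sums over partial orientations\<close>

definition bump :: "'b \<Rightarrow> ('b \<Rightarrow> nat) \<Rightarrow> 'b \<Rightarrow> nat" where
  "bump x k = k(x := Suc (k x))"

text \<open>Each pair in \<open>E\<close> stands for a vertex shared by copies \<open>l\<close> and
  \<open>m\<close>, with three options: uncovered, covered inside copy \<open>l\<close>, covered
  inside copy \<open>m\<close>. The accumulator \<open>k\<close> holds the number of outmost
  vertices covered so far in each copy.\<close>

fun orient_sum :: "'b set \<Rightarrow> (nat \<Rightarrow> 'a::comm_semiring_1) \<Rightarrow> ('b \<times> 'b) list \<Rightarrow> ('b \<Rightarrow> nat) \<Rightarrow> 'a" where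
  "orient_sum V a [] k = (\<Prod>l\<in>V. a (k l))"
| "orient_sum V a ((l, m) # E) k =
     orient_sum V a E k + orient_sum V a E (bump l k) + orient_sum V a E (bump m k)"

text \<open>Partial orientations of a graph: a pair may be directed either way or left out, and
  antisymmetry forbids both directions together.\<close>

definition orientations :: "('b \<times> 'b) set \<Rightarrow> ('b \<times> 'b) set set" where
  "orientations E = {R. R \<subseteq> E \<union> E\<inverse> \<and> antisym R}"

lemma finite_orientations: "finite E \<Longrightarrow> finite (orientations E)"
  by (rule finite_subset[of _ "Pow (E \<union> E\<inverse>)"]) (auto simp: orientations_def)

text \<open>Relations are sorted by their choice on the new pair. That choice is independent of the
  rest because neither direction occurs in \<open>E\<close>.\<close>

lemma orientations_insert:
  assumes "l \<noteq> m" "(l, m) \<notin> E" "(m, l) \<notin> E"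
  shows "orientations (insert (l, m) E) =
    orientations E \<union> insert (l, m) ` orientations E \<union> insert (m, l) ` orientations E"
proof (intro equalityI subsetI)
  fix R assume R: "R \<in> orientations (insert (l, m) E)"
  define R' where "R' = R - {(l, m), (m, l)}"
  have "R' \<in> orientations E"
    using R by (auto simp: orientations_def R'_def antisym_def)
  moreover have "R = R' \<or> R = insert (l, m) R' \<or> R = insert (m, l) R'"
    using R assms(1) by (auto simp: orientations_def R'_def antisym_def)
  ultimately show "R \<in> orientations E \<union> insert (l, m) ` orientations E
      \<union> insert (m, l) ` orientations E"
    by blast
next
  fix R assume "R \<in> orientations E \<union> insert (l, m) ` orientations E
      \<union> insert (m, l) ` orientations E"
  moreover have "insert (l, m) R \<in> orientations (insert (l, m) E)"
    "insert (m, l) R \<in> orientations (insert (l, m) E)"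
    "R \<in> orientations (insert (l, m) E)" if "R \<in> orientations E" for R
    using that assms by (auto simp: orientations_def antisym_def)
  ultimately show "R \<in> orientations (insert (l, m) E)"
    by blast
qed

text \<open>Induction on \<open>E\<close>: the three summands match the three choices on the first
  pair. Distinctness together with \<open>l < m\<close> ensures that no pair reappears later in
  either direction.\<close>

lemma orient_sum_eq_sum_orientations:
  fixes E :: "('b::linorder \<times> 'b) list"
  assumes "distinct E" "\<forall>(l, m)\<in>set E. l < m"
  shows "orient_sum V a E k = (\<Sum>R\<in>orientations (set E). \<Prod>l\<in>V. a (k l + card (R `` {l})))"
  using assms
proof (induction E arbitrary: k)
  case Nil
  have "orientations {} = {{}::('b \<times> 'b) set}"
    by (auto simp: orientations_def)
  then show ?case by simp
next
  case (Cons e E)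
  obtain l m where e: "e = (l, m)" by fastforce
  define w where "w k R = (\<Prod>x\<in>V. a (k x + card (R `` {x})))" for k :: "'b \<Rightarrow> nat" and R :: "('b \<times> 'b) set"
  have lm: "l \<noteq> m" "(l, m) \<notin> set E" "(m, l) \<notin> set E"
    using Cons.prems e by auto
  let ?O = "orientations (set E)"
  have notin: "(l, m) \<notin> R \<and> (m, l) \<notin> R" if "R \<in> ?O" for R
    using that lm by (auto simp: orientations_def)
  have fin: "finite ?O"
    by (simp add: finite_orientations)
  \<comment> \<open>The new arrow out of \<open>x\<close> raises the out-degree of \<open>x\<close>
    by one and changes no other, which is the effect of \<open>bump x\<close>.\<close>
  have add: "sum (w k) (insert (x, y) ` ?O) = sum (w (bump x k)) ?O"
    if xy: "(x, y) \<in> {(l, m), (m, l)}" for x y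
  proof -
    have "inj_on (insert (x, y)) ?O"
      using notin xy by (auto simp: inj_on_def insert_ident)
    moreover have "w k (insert (x, y) R) = w (bump x k) R" if "R \<in> ?O" for R
    proof -
      have "finite R"
        using that by (auto simp: orientations_def elim: finite_subset)
      then have fin: "finite (R `` {x})"
        by (simp add: finite_Image)
      have "insert (x, y) R `` {z} = (if z = x then insert y (R `` {z}) else R `` {z})" for z
        by auto
      then have "k z + card (insert (x, y) R `` {z}) = bump x k z + card (R `` {z})" for z
        using notin[OF that] xy fin by (auto simp: bump_def)
      then show ?thesis by (simp add: w_def)
    qed
    ultimately show ?thesis
      by (simp add: sum.reindex)
  qed
  have "orient_sum V a (e # E) k = sum (w k) ?O + sum (w (bump l k)) ?O + sum (w (bump m k)) ?O"
    using Cons by (simp add: e w_def)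
  also have "\<dots> = sum (w k) ?O + sum (w k) (insert (l, m) ` ?O) + sum (w k) (insert (m, l) ` ?O)"
    by (simp add: add)
  also have "\<dots> = sum (w k) (?O \<union> insert (l, m) ` ?O \<union> insert (m, l) ` ?O)"
  proof -
    have "?O \<inter> insert (l, m) ` ?O = {}" "(?O \<union> insert (l, m) ` ?O) \<inter> insert (m, l) ` ?O = {}"
      using notin lm(1) by blast+
    then show ?thesis
      using fin by (simp add: sum.union_disjoint)
  qed
  also have "\<dots> = sum (w k) (orientations (set (e # E)))"
    using orientations_insert[OF lm] by (simp add: e)
  finally show ?case by (simp add: w_def)
qed

text \<open>Off the diagonal an interface relation is a partial orientation of all pairs of labels.
  Its diagonal is fixed as \<open>Id_on S\<close> and adds one to the out-degree of each element of
  \<open>S\<close>; this is the starting value of the accumulator.\<close>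

lemma sum_interfaces_eq_orient_sum:
  fixes E :: "('b::linorder \<times> 'b) list"
  assumes "finite V" "distinct E" "set E = {(l, m). l \<in> V \<and> m \<in> V \<and> l < m}" "S \<subseteq> V"
  shows "(\<Sum>R\<in>interfaces V S. \<Prod>l\<in>V. a (card (R `` {l}))) =
    orient_sum V a E (\<lambda>l. if l \<in> S then 1 else 0)"
proof -
  have "orient_sum V a E (\<lambda>l. if l \<in> S then 1 else 0) =
     (\<Sum>R\<in>orientations (set E). \<Prod>l\<in>V. a ((if l \<in> S then 1 else 0) + card (R `` {l})))"
    using assms by (intro orient_sum_eq_sum_orientations) auto
  also have "\<dots> = (\<Sum>R\<in>interfaces V S. \<Prod>l\<in>V. a (card (R `` {l})))"
  proof (rule sum.reindex_bij_witness[where i = "\<lambda>R. R - Id" and j = "\<lambda>R. R \<union> Id_on S"])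
    fix R assume R: "R \<in> orientations (set E)"
    have irr: "(x, x) \<notin> R" for x
      using R assms(3) by (auto simp: orientations_def)
    then show "(R \<union> Id_on S) - Id = R" by auto
    have RV: "R \<subseteq> V \<times> V"
      using R assms(3) by (auto simp: orientations_def)
    then show "R \<union> Id_on S \<in> interfaces V S"
      using R assms(4) irr unfolding interfaces_def orientations_def antisym_def by auto
    have "card ((R \<union> Id_on S) `` {l}) = (if l \<in> S then 1 else 0) + card (R `` {l})" for l
    proof -
      have "finite (R `` {l})"
        using RV assms(1) finite_subset[of "R `` {l}" V] by auto
      moreover have "(R \<union> Id_on S) `` {l} = (if l \<in> S then insert l (R `` {l}) else R `` {l})"
        by auto
      ultimately show ?thesis
        using irr by simp
    qed
    then show "(\<Prod>l\<in>V. a (card ((R \<union> Id_on S) `` {l}))) =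
        (\<Prod>l\<in>V. a ((if l \<in> S then 1 else 0) + card (R `` {l})))"
      by simp
  next
    fix R assume R: "R \<in> interfaces V S"
    then show "(R - Id) \<union> Id_on S = R"
      by (auto simp: interfaces_def)
    show "R - Id \<in> orientations (set E)"
      using R by (auto simp: interfaces_def orientations_def assms(3) antisym_def)
  qed
  finally show ?thesis by simp
qed

section \<open>Stage 0: perfect matchings of complete graphs\<close>

definition perfect_matchings :: "'a set \<Rightarrow> 'a set set set" where
  "perfect_matchings T = {M. (\<forall>e\<in>M. card e = 2) \<and> pairwise disjnt M \<and> \<Union>M = T}"

text \<open>The double factorial \<open>(n - 1)!!\<close> for even \<open>n\<close>, zero for odd
  \<open>n\<close>.\<close>

fun perfect_matching_number :: "nat \<Rightarrow> nat" where
  "perfect_matching_number 0 = 1"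
| "perfect_matching_number (Suc 0) = 0"
| "perfect_matching_number (Suc (Suc n)) = Suc n * perfect_matching_number n"

lemma finite_perfect_matchings: "finite T \<Longrightarrow> finite (perfect_matchings T)"
  by (rule finite_subset[of _ "Pow (Pow T)"]) (auto simp: perfect_matchings_def)

text \<open>Perfect matchings are sorted by the partner \<open>y\<close> of the fixed element
  \<open>x\<close>.\<close>

lemma perfect_matchings_rec:
  assumes "x \<in> T"
  shows "perfect_matchings T = (\<Union>y\<in>T - {x}. insert {x, y} ` perfect_matchings (T - {x, y}))"
proof (intro equalityI subsetI)
  fix M assume M: "M \<in> perfect_matchings T"
  then obtain e where e: "e \<in> M" "x \<in> e"
    using assms by (auto simp: perfect_matchings_def)
  then have "card e = 2"
    using M by (auto simp: perfect_matchings_def)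
  then obtain y where y: "e = {x, y}" "x \<noteq> y"
    using e(2) by (auto simp: card_2_iff)
  have "\<Union>(M - {e}) = T - {x, y}"
  proof -
    have "disjnt e e'" if "e' \<in> M - {e}" for e'
      using M e(1) that by (auto simp: perfect_matchings_def pairwise_def)
    moreover have "\<Union>M = T"
      using M by (simp add: perfect_matchings_def)
    ultimately show ?thesis
      using e(1) y(1) unfolding disjnt_def by blast
  qed
  then have "M - {e} \<in> perfect_matchings (T - {x, y})"
    using M by (auto simp: perfect_matchings_def pairwise_def)
  moreover have "M = insert {x, y} (M - {e})" "y \<in> T - {x}"
    using e y M by (auto simp: perfect_matchings_def)
  ultimately show "M \<in> (\<Union>y\<in>T - {x}. insert {x, y} ` perfect_matchings (T - {x, y}))"
    by blast
next
  fix M assume "M \<in> (\<Union>y\<in>T - {x}. insert {x, y} ` perfect_matchings (T - {x, y}))"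
  then obtain y N where y: "y \<in> T - {x}" "N \<in> perfect_matchings (T - {x, y})"
    and M: "M = insert {x, y} N"
    by blast
  then have "\<forall>e\<in>N. disjnt {x, y} e"
    by (auto simp: perfect_matchings_def disjnt_iff)
  then show "M \<in> perfect_matchings T"
    using y assms by (auto simp: perfect_matchings_def M pairwise_insert disjnt_sym)
qed

lemma card_perfect_matchings:
  assumes "finite T"
  shows "card (perfect_matchings T) = perfect_matching_number (card T)"
  using assms
proof (induction "card T" arbitrary: T rule: perfect_matching_number.induct)
  case 1
  then have "e \<noteq> {}" if "card e = 2" for e :: "'a set"
    using that by auto
  with 1 have "perfect_matchings T = {{}}"
    by (auto simp: perfect_matchings_def)
  with 1 show ?case by simp
next
  case 2
  then obtain x where "T = {x}"
    by (metis One_nat_def card_1_singletonE)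
  then have "perfect_matchings T = {}"
    by (simp add: perfect_matchings_rec[of x])
  with 2(1) show ?case by (simp flip: 2(1))
next
  case (3 n)
  then obtain x where x: "x \<in> T"
    by fastforce
  let ?F = "\<lambda>y. insert {x, y} ` perfect_matchings (T - {x, y})"
  \<comment> \<open>As the remaining pairs avoid \<open>x\<close>, the matching determines the
    partner of \<open>x\<close>: classes for different partners are disjoint, and inserting the pair
    is injective.\<close>
  have cov: "x \<notin> \<Union>N" if "N \<in> perfect_matchings (T - {x, y})" for N y
    using that by (auto simp: perfect_matchings_def)
  have "card (perfect_matchings T) = (\<Sum>y\<in>T - {x}. card (?F y))"
    unfolding perfect_matchings_rec[OF x]
  proof (rule card_UN_disjoint)
    show "\<forall>y\<in>T - {x}. \<forall>z\<in>T - {x}. y \<noteq> z \<longrightarrow> ?F y \<inter> ?F z = {}"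
    proof (intro ballI impI equals0I)
      fix y z M assume yz: "y \<in> T - {x}" "z \<in> T - {x}" "y \<noteq> z" and M: "M \<in> ?F y \<inter> ?F z"
      then obtain N where "M = insert {x, y} N" "N \<in> perfect_matchings (T - {x, y})"
        by blast
      moreover have "{x, z} \<in> M" "{x, z} \<noteq> {x, y}"
        using M yz by (auto simp: doubleton_eq_iff)
      ultimately show False
        using cov by blast
    qed
  qed (use 3 in \<open>auto simp: finite_perfect_matchings\<close>)
  also have "\<dots> = (\<Sum>y\<in>T - {x}. perfect_matching_number n)"
  proof (rule sum.cong)
    fix y assume y: "y \<in> T - {x}"
    have T: "card T = Suc (Suc n)"
      using 3(2) by simp
    have "inj_on (insert {x, y}) (perfect_matchings (T - {x, y}))"
      unfolding inj_on_def using cov by (metis UnionI insertI1 insert_ident)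
    moreover have "card (T - {x, y}) = n"
      using x y T card_Diff_subset[of "{x, y}" T] by (simp add: eq_commute[of x y])
    ultimately show "card (?F y) = perfect_matching_number n"
      using 3(1)[of "T - {x, y}"] 3(3) by (simp add: card_image)
  qed simp
  also have "\<dots> = perfect_matching_number (card T)"
    using x 3(3) by (simp flip: 3(2))
  finally show ?case .
qed

text \<open>At stage 0 every vertex is outmost and any two are adjacent, so covering exactly
  \<open>S\<close> means matching \<open>S\<close> perfectly.\<close>

lemma matchings_0:
  assumes "S \<subseteq> labels d"
  shows "matchings d 0 S = perfect_matchings (outmost 0 ` S)"
proof -
  have edges: "sedges d 0 = {e. e \<subseteq> outmost 0 ` labels d \<and> card e = 2}"
  proof
    show "{e. e \<subseteq> outmost 0 ` labels d \<and> card e = 2} \<subseteq> sedges d 0"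
      unfolding sedges_0 card_2_iff by fastforce
  qed (use sedges_subset[of d 0] in \<open>simp add: sverts_0\<close>)
  have cov: "covered d 0 M = S \<longleftrightarrow> \<Union>M = outmost 0 ` S" if "\<Union>M \<subseteq> outmost 0 ` labels d" for M
    using that assms unfolding covered_def by (auto simp: set_eq_iff image_iff subset_iff; blast)
  have sub: "\<Union>M \<subseteq> outmost 0 ` labels d" if "\<Union>M = outmost 0 ` S" for M
    using that assms by blast
  have "M \<in> matchings d 0 S \<longleftrightarrow> M \<in> perfect_matchings (outmost 0 ` S)" for M
  proof -
    have "M \<subseteq> sedges d 0 \<longleftrightarrow> (\<forall>e\<in>M. card e = 2) \<and> \<Union>M \<subseteq> outmost 0 ` labels d"
      unfolding edges by blast
    then show ?thesis
      using cov[of M] sub[of M]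
      unfolding matchings_def perfect_matchings_def dimer_monomer_iff mem_Collect_eq by argo
  qed
  then show ?thesis by blast
qed

lemma card_matchings_0:
  assumes "S \<subseteq> labels d"
  shows "card (matchings d 0 S) = perfect_matching_number (card S)"
proof -
  have "finite S"
    using assms finite_labels finite_subset by blast
  then show ?thesis
    by (simp add: matchings_0[OF assms] card_perfect_matchings card_image inj_on_def
      del: outmost.simps)
qed

section \<open>Bounds preserved by the recursion\<close>

text \<open>For pairs of distinct labels this bounds how often the index at \<open>x\<close> can
  still rise while \<open>orient_sum\<close> runs through \<open>E\<close>.\<close>

definition degree :: "('b \<times> 'b) list \<Rightarrow> 'b \<Rightarrow> nat" where
  "degree E x = length (filter (\<lambda>(l, m). l = x \<or> m = x) E)"

lemma bump_commute: "bump x (bump y k) = bump y (bump x k)"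
  by (simp add: bump_def fun_eq_iff)

lemma orient_sum_nonneg:
  fixes a :: "nat \<Rightarrow> real"
  assumes "\<And>j. 0 \<le> a j"
  shows "0 \<le> orient_sum V a E k"
  using assms by (induction V a E k rule: orient_sum.induct) (auto simp: prod_nonneg)

text \<open>Both sums run over the same choices, and corresponding terms differ only in the factor
  at \<open>x\<close>, whose index is one higher. The bound by \<open>D\<close> keeps that index in
  the range where the ratios are controlled.\<close>

lemma orient_sum_bump_bounds:
  fixes a :: "nat \<Rightarrow> real"
  assumes "finite V" "x \<in> V" "\<And>j. 0 \<le> a j"
    and "\<And>j. j < D \<Longrightarrow> \<alpha> * a j \<le> a (Suc j) \<and> a (Suc j) \<le> \<beta> * a j"
    and "k x + degree E x < D"
  shows "\<alpha> * orient_sum V a E k \<le> orient_sum V a E (bump x k) \<and>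
    orient_sum V a E (bump x k) \<le> \<beta> * orient_sum V a E k"
  using assms(5)
proof (induction E arbitrary: k)
  case Nil
  let ?P = "\<Prod>l\<in>V - {x}. a (k l)"
  have "(\<Prod>l\<in>V. a (bump x k l)) = a (Suc (k x)) * (\<Prod>l\<in>V - {x}. a (bump x k l))"
    using assms(1,2) by (simp add: prod.remove bump_def)
  also have "(\<Prod>l\<in>V - {x}. a (bump x k l)) = ?P"
    by (rule prod.cong) (auto simp: bump_def)
  finally have bumped: "(\<Prod>l\<in>V. a (bump x k l)) = a (Suc (k x)) * ?P" .
  have "(\<Prod>l\<in>V. a (k l)) = a (k x) * ?P"
    using assms(1,2) by (simp add: prod.remove)
  moreover have "0 \<le> ?P"
    using assms(3) by (simp add: prod_nonneg)
  moreover have "\<alpha> * a (k x) \<le> a (Suc (k x))" "a (Suc (k x)) \<le> \<beta> * a (k x)"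
    using Nil assms(4) by (auto simp: degree_def)
  ultimately show ?case
    using mult_right_mono[of _ _ ?P] by (simp add: bumped flip: mult.assoc)
next
  case (Cons e E)
  obtain l m where e: "e = (l, m)" by fastforce
  have "k x + degree E x < D" "bump l k x + degree E x < D" "bump m k x + degree E x < D"
    using Cons.prems by (auto simp: e degree_def bump_def split: if_splits)
  from Cons.IH[of k, OF this(1)] Cons.IH[of "bump l k", OF this(2)] Cons.IH[of "bump m k", OF this(3)]
  show ?case
    by (simp add: e bump_commute[of x] distrib_left)
qed

text \<open>Removing one pair leaves three sums, two of which lie between \<open>\<alpha>\<close>
  and \<open>\<beta>\<close> times the third. So each pair contributes a factor between
  \<open>1 + 2 * \<alpha>\<close> and \<open>1 + 2 * \<beta>\<close>.\<close>

lemma orient_sum_bounds: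
  fixes a :: "nat \<Rightarrow> real"
  assumes "finite V" "\<And>j. 0 \<le> a j" "0 \<le> \<alpha>" "0 \<le> \<beta>"
    and "\<And>j. j < D \<Longrightarrow> \<alpha> * a j \<le> a (Suc j) \<and> a (Suc j) \<le> \<beta> * a j"
    and "set E \<subseteq> V \<times> V" "\<And>x. x \<in> V \<Longrightarrow> k x + degree E x \<le> D"
  shows "(1 + 2 * \<alpha>) ^ length E * (\<Prod>l\<in>V. a (k l)) \<le> orient_sum V a E k \<and>
    orient_sum V a E k \<le> (1 + 2 * \<beta>) ^ length E * (\<Prod>l\<in>V. a (k l))"
  using assms(6,7)
proof (induction E)
  case Nil
  then show ?case by simp
next
  case (Cons e E)
  obtain l m where e: "e = (l, m)" by fastforce
  have lm: "l \<in> V" "m \<in> V"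
    using Cons.prems e by auto
  have "k x + degree E x \<le> D" if "x \<in> V" for x
    using Cons.prems(2)[OF that] by (auto simp: e degree_def split: if_splits)
  then have IH: "(1 + 2 * \<alpha>) ^ length E * (\<Prod>l\<in>V. a (k l)) \<le> orient_sum V a E k \<and>
    orient_sum V a E k \<le> (1 + 2 * \<beta>) ^ length E * (\<Prod>l\<in>V. a (k l))"
    using Cons by simp
  have "k l + degree E l < D" "k m + degree E m < D"
    using Cons.prems(2)[of l] Cons.prems(2)[of m] lm by (auto simp: e degree_def)
  then have "\<alpha> * orient_sum V a E k \<le> orient_sum V a E (bump x k) \<and>
    orient_sum V a E (bump x k) \<le> \<beta> * orient_sum V a E k"
    if "x \<in> {l, m}" for x
    using that lm assms(1,2,5) by (intro orient_sum_bump_bounds[where D = D]) auto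
  from this[of l] this[of m]
  have "(1 + 2 * \<alpha>) * orient_sum V a E k \<le> orient_sum V a (e # E) k"
    "orient_sum V a (e # E) k \<le> (1 + 2 * \<beta>) * orient_sum V a E k"
    by (auto simp: e algebra_simps)
  moreover have "(1 + 2 * \<alpha>) * ((1 + 2 * \<alpha>) ^ length E * (\<Prod>l\<in>V. a (k l)))
      \<le> (1 + 2 * \<alpha>) * orient_sum V a E k"
    "(1 + 2 * \<beta>) * orient_sum V a E k \<le> (1 + 2 * \<beta>) * ((1 + 2 * \<beta>) ^ length E * (\<Prod>l\<in>V. a (k l)))"
    using IH assms(3,4) by (intro mult_left_mono; simp)+
  ultimately show ?case
    by (simp add: mult.assoc)
qed

section \<open>Counts on the three-dimensional gasket and their ratios\<close>

abbreviation "K4 \<equiv> [(1::nat,2::nat),(1,3),(1,4),(2,3),(2,4),(3,4)]"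

lemma labels_3: "labels 3 = {1, 2, 3, 4}"
  by (auto simp: labels_def)

text \<open>Only the number of covered outmost vertices matters, so they are taken to be
  \<open>{1..k}\<close>. The pairs in \<open>K4\<close> are the six glued vertices.\<close>

primrec matching_count :: "nat \<Rightarrow> nat \<Rightarrow> real" where
  "matching_count 0 = (\<lambda>k. real (perfect_matching_number k))"
| "matching_count (Suc n) =
    (\<lambda>k. orient_sum (labels 3) (matching_count n) K4 (\<lambda>l. if l \<in> {1..k} then 1 else 0))"

declare orient_sum.simps [simp del] matching_count.simps [simp del]

lemma card_matchings:
  assumes "S \<subseteq> labels 3"
  shows "real (card (matchings 3 n S)) = matching_count n (card S)"
  using assms
proof (induction n arbitrary: S)
  case 0
  then show ?case by (simp add: card_matchings_0 matching_count.simps)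
next
  case (Suc n)
  have "card S \<le> 4"
    using card_mono[OF _ Suc.prems] by (simp add: labels_def)
  then have T: "{1..card S} \<subseteq> labels 3"
    by (auto simp: labels_def)
  have "real (card (matchings 3 (Suc n) S)) =
      (\<Sum>R\<in>interfaces (labels 3) S. \<Prod>l\<in>labels 3. matching_count n (card (R `` {l})))"
    unfolding card_matchings_Suc of_nat_sum of_nat_prod
  proof (intro sum.cong prod.cong refl Suc.IH)
    fix R l assume "R \<in> interfaces (labels 3) S"
    then show "R `` {l} \<subseteq> labels 3"
      by (auto simp: interfaces_def)
  qed
  also have "\<dots> = (\<Sum>R\<in>interfaces (labels 3) {1..card S}.
      \<Prod>l\<in>labels 3. matching_count n (card (R `` {l})))"
    using Suc.prems T by (intro sum_interfaces_eq) auto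
  also have "\<dots> = matching_count (Suc n) (card S)"
    unfolding matching_count.simps
    by (rule sum_interfaces_eq_orient_sum) (use T in \<open>auto simp: labels_3\<close>)
  finally show ?case .
qed

lemma matching_count_nonneg: "0 \<le> matching_count n k"
  by (induction n arbitrary: k) (auto simp: matching_count.simps intro: orient_sum_nonneg)

text \<open>Ratio bounds in product form, so that zero counts such as those at stage 0 need no
  special treatment.\<close>

definition trapped :: "real \<Rightarrow> real \<Rightarrow> nat \<Rightarrow> bool" where
  "trapped \<alpha> \<beta> n \<longleftrightarrow> (\<forall>k<4. \<alpha> * matching_count n k \<le> matching_count n (Suc k) \<and>
     matching_count n (Suc k) \<le> \<beta> * matching_count n k)"

lemma degree_K4: "x \<in> labels 3 \<Longrightarrow> degree K4 x = 3"
  by (auto simp: labels_3 degree_def)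

text \<open>Going from \<open>{1..k}\<close> to \<open>{1..Suc k}\<close> raises the starting index
  of copy \<open>Suc k\<close> by one, so \<open>orient_sum_bump_bounds\<close> applies with the
  ratio bounds of the previous stage.\<close>

lemma trapped_Suc:
  assumes "trapped \<alpha> \<beta> n"
  shows "trapped \<alpha> \<beta> (Suc n)"
  unfolding trapped_def
proof (intro allI impI)
  fix k :: nat assume k: "k < 4"
  define c :: "nat \<Rightarrow> nat \<Rightarrow> nat" where "c k = (\<lambda>l. if l \<in> {1..k} then 1 else 0)" for k
  have count: "matching_count (Suc n) j = orient_sum (labels 3) (matching_count n) K4 (c j)" for j
    by (simp only: matching_count.simps c_def)
  have bump: "c (Suc k) = bump (Suc k) (c k)"
    by (auto simp: c_def bump_def fun_eq_iff)
  have x: "Suc k \<in> labels 3"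
    using k by (simp add: labels_def)
  show "\<alpha> * matching_count (Suc n) k \<le> matching_count (Suc n) (Suc k) \<and>
      matching_count (Suc n) (Suc k) \<le> \<beta> * matching_count (Suc n) k"
    unfolding count bump
  proof (rule orient_sum_bump_bounds[where D = 4])
    \<comment> \<open>The index of copy \<open>Suc k\<close> starts at 0 and is raised by at most
      its three glued vertices.\<close>
    show "c k (Suc k) + degree K4 (Suc k) < 4"
      using degree_K4[OF x] by (simp add: c_def)
  qed (use assms x in \<open>auto simp: matching_count_nonneg trapped_def\<close>)
qed

text \<open>The exponent 6 counts the glued vertices and the exponent 4 the copies.\<close>

lemma matching_count_Suc_bounds:
  assumes "trapped \<alpha> \<beta> n" "0 \<le> \<alpha>" "0 \<le> \<beta>"
  shows "(1 + 2 * \<alpha>) ^ 6 * matching_count n 0 ^ 4 \<le> matching_count (Suc n) 0"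
    "matching_count (Suc n) 0 \<le> (1 + 2 * \<beta>) ^ 6 * matching_count n 0 ^ 4"
proof -
  have count: "matching_count (Suc n) 0 = orient_sum (labels 3) (matching_count n) K4 (\<lambda>l. 0)"
    unfolding matching_count.simps by (rule arg_cong[of _ _ "orient_sum _ _ _"]) auto
  have "card (labels 3) = 4" "length K4 = 6"
    by (simp_all add: labels_def)
  moreover have "(1 + 2 * \<alpha>) ^ length K4 * (\<Prod>l\<in>labels 3. matching_count n 0) \<le> matching_count (Suc n) 0 \<and>
    matching_count (Suc n) 0 \<le> (1 + 2 * \<beta>) ^ length K4 * (\<Prod>l\<in>labels 3. matching_count n 0)"
    unfolding count
  proof (rule orient_sum_bounds[where D = 4])
    show "set K4 \<subseteq> labels 3 \<times> labels 3"
      by (simp add: labels_3)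
    show "0 + degree K4 x \<le> 4" if "x \<in> labels 3" for x
      using degree_K4[OF that] by simp
  qed (use assms in \<open>auto simp: matching_count_nonneg trapped_def\<close>)
  ultimately show "(1 + 2 * \<alpha>) ^ 6 * matching_count n 0 ^ 4 \<le> matching_count (Suc n) 0"
    "matching_count (Suc n) 0 \<le> (1 + 2 * \<beta>) ^ 6 * matching_count n 0 ^ 4"
    by (simp_all only: prod_constant)
qed

section \<open>Existence and bounds of the growth constant\<close>

lemma quadrupling_limit:
  fixes b :: "nat \<Rightarrow> real"
  assumes "\<And>n. n \<ge> N \<Longrightarrow> 4 * b n + P \<le> b (Suc n)" "\<And>n. n \<ge> N \<Longrightarrow> b (Suc n) \<le> 4 * b n + Q"
  shows "\<exists>L. (\<lambda>n. b n / 4 ^ n) \<longlonglongrightarrow> L \<and> (b N + P / 3) / 4 ^ N \<le> L \<and> L \<le> (b N + Q / 3) / 4 ^ N"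
proof -
  \<comment> \<open>The fixed point of \<open>x \<mapsto> 4 * x + P\<close> is
    \<open>- P / 3\<close>. After this shift the lower estimate is plain multiplication by 4, so
    \<open>u\<close> increases from stage \<open>N\<close> on; likewise \<open>w\<close>
    decreases.\<close>
  define u where "u n = (b n + P / 3) / 4 ^ n" for n
  define w where "w n = (b n + Q / 3) / 4 ^ n" for n
  have u: "u n \<le> u (Suc n)" and w: "w (Suc n) \<le> w n" if "n \<ge> N" for n
    using divide_right_mono[OF assms(1)[OF that], of "4 ^ Suc n"]
      divide_right_mono[OF assms(2)[OF that], of "4 ^ Suc n"]
    by (simp_all add: u_def w_def add_divide_distrib)
  have "4 * b N + P \<le> 4 * b N + Q"
    using assms(1,2)[of N] by simp
  then have uw: "u n \<le> w n" for n
    by (simp add: u_def w_def divide_right_mono)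
  have inc: "incseq (\<lambda>n. u (n + N))" and dec: "decseq (\<lambda>n. w (n + N))"
    by (auto intro!: incseq_SucI decseq_SucI u w)
  have le: "u (n + N) \<le> w N" for n
    using uw[of "n + N"] decseqD[OF dec, of 0 n] by simp
  obtain L where L: "(\<lambda>n. u (n + N)) \<longlonglongrightarrow> L" "\<forall>n. u (n + N) \<le> L"
    using incseq_convergent[OF inc, of "w N"] le by blast
  have "L \<le> w N"
    using LIMSEQ_le_const2[OF L(1)] le by blast
  moreover have "u N \<le> L"
    using L(2)[rule_format, of 0] by simp
  \<comment> \<open>Divided by \<open>4 ^ n\<close> the shift tends to 0, so
    \<open>b n / 4 ^ n\<close> has the limit of \<open>u\<close>.\<close>
  moreover have "(\<lambda>n. u n - P / 3 * (1 / 4) ^ n) \<longlonglongrightarrow> L - P / 3 * 0"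
    by (intro tendsto_intros LIMSEQ_realpow_zero LIMSEQ_offset[OF L(1)]) auto
  moreover have "u n - P / 3 * (1 / 4) ^ n = b n / 4 ^ n" for n
    by (simp add: u_def field_simps)
  ultimately show ?thesis
    unfolding u_def w_def by auto
qed

text \<open>The total is a sum over the 16 sets of covered outmost vertices, each term reached from
  \<open>matching_count n 0\<close> by at most four ratio steps. Hence the logarithms of the total
  and of \<open>matching_count n 0\<close> differ by a bounded amount.\<close>

lemma N_DM_bounds:
  assumes "trapped \<alpha> \<beta> n" "1 \<le> \<beta>"
  shows "matching_count n 0 \<le> real (N_DM (sierpinski 3 n))"
    "real (N_DM (sierpinski 3 n)) \<le> 16 * \<beta> ^ 4 * matching_count n 0"
proof -
  have N: "real (N_DM (sierpinski 3 n)) = (\<Sum>S\<in>Pow (labels 3). matching_count n (card S))"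
    by (simp add: N_DM_eq_sum card_matchings)
  have "matching_count n (card ({} :: nat set)) \<le> (\<Sum>S\<in>Pow (labels 3). matching_count n (card S))"
    by (rule member_le_sum) (auto simp: matching_count_nonneg)
  then show "matching_count n 0 \<le> real (N_DM (sierpinski 3 n))"
    by (simp add: N)
  have pow: "matching_count n k \<le> \<beta> ^ k * matching_count n 0" if "k \<le> 4" for k
    using that
  proof (induction k)
    case (Suc k)
    then have "matching_count n (Suc k) \<le> \<beta> * matching_count n k"
      using assms(1) by (simp add: trapped_def)
    also have "\<dots> \<le> \<beta> * (\<beta> ^ k * matching_count n 0)"
      using Suc assms(2) by (intro mult_left_mono) auto
    finally show ?case by (simp add: mult.assoc)
  qed simp
  have "(\<Sum>S\<in>Pow (labels 3). matching_count n (card S)) \<le>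
      of_nat (card (Pow (labels 3))) * (\<beta> ^ 4 * matching_count n 0)"
  proof (rule sum_bounded_above)
    fix S assume "S \<in> Pow (labels 3)"
    then have "card S \<le> 4"
      using card_mono[of "labels 3" S] by (simp add: labels_def)
    then have "matching_count n (card S) \<le> \<beta> ^ card S * matching_count n 0" "\<beta> ^ card S \<le> \<beta> ^ 4"
      using assms(2) by (auto intro: pow power_increasing)
    then show "matching_count n (card S) \<le> \<beta> ^ 4 * matching_count n 0"
      by (meson matching_count_nonneg mult_right_mono order_trans)
  qed
  then show "real (N_DM (sierpinski 3 n)) \<le> 16 * \<beta> ^ 4 * matching_count n 0"
    by (simp add: N card_Pow labels_def)
qed

text \<open>Taking logarithms in \<open>matching_count_Suc_bounds\<close> gives a quadrupling
  recursion with additive terms \<open>6 * ln (1 + 2 * \<alpha>)\<close> and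
  \<open>6 * ln (1 + 2 * \<beta>)\<close>; a third of these appears in the bounds. The other factor
  2 in the denominators comes from the vertex count \<open>2 * (4 ^ n + 1)\<close>.\<close>

lemma growth_constant:
  assumes "trapped \<alpha> \<beta> N" "0 \<le> \<alpha>" "1 \<le> \<beta>" "0 < matching_count N 0"
  shows "\<exists>z. (\<lambda>n. ln (real (N_DM (sierpinski 3 n))) / real (card (sverts 3 n))) \<longlonglongrightarrow> z \<and>
    (ln (matching_count N 0) + 2 * ln (1 + 2 * \<alpha>)) / (2 * 4 ^ N) \<le> z \<and>
    z \<le> (ln (matching_count N 0) + 2 * ln (1 + 2 * \<beta>)) / (2 * 4 ^ N)"
proof -
  let ?f = "\<lambda>n. matching_count n 0"
  let ?M = "\<lambda>n. real (N_DM (sierpinski 3 n))"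
  have tr: "trapped \<alpha> \<beta> n" if "n \<ge> N" for n
    using that by (induction n rule: dec_induct) (auto intro: assms(1) trapped_Suc)
  note bounds = matching_count_Suc_bounds[OF tr assms(2)]
  have pos: "0 < ?f n" if "n \<ge> N" for n
    using that
  proof (induction n rule: dec_induct)
    case (step n)
    then have "0 < (1 + 2 * \<alpha>) ^ 6 * ?f n ^ 4"
      using assms(2) by simp
    then show ?case
      using bounds(1)[of n] step assms(3) by simp
  qed (rule assms(4))
  have ln_pow: "ln (x ^ 6 * ?f n ^ 4) = 4 * ln (?f n) + 6 * ln x" if "x > 0" "n \<ge> N" for x n
    using that pos[of n] by (simp add: ln_mult ln_realpow)
  have "4 * ln (?f n) + 6 * ln (1 + 2 * \<alpha>) \<le> ln (?f (Suc n))"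
    "ln (?f (Suc n)) \<le> 4 * ln (?f n) + 6 * ln (1 + 2 * \<beta>)" if "n \<ge> N" for n
    using bounds[of n] pos[of n] pos[of "Suc n"] that assms(2,3)
    by (simp_all flip: ln_pow)
  from quadrupling_limit[of N "\<lambda>n. ln (?f n)", OF this]
  obtain L where L: "(\<lambda>n. ln (?f n) / 4 ^ n) \<longlonglongrightarrow> L"
    "(ln (?f N) + 2 * ln (1 + 2 * \<alpha>)) / 4 ^ N \<le> L" "L \<le> (ln (?f N) + 2 * ln (1 + 2 * \<beta>)) / 4 ^ N"
    by auto
  have zero: "(\<lambda>n. c * (1 / 4) ^ n) \<longlonglongrightarrow> 0" for c :: real
    using tendsto_mult_left[OF LIMSEQ_realpow_zero[of "1 / 4 :: real"], of c] by simp
  have "(\<lambda>n. ln (?M n) / 4 ^ n - ln (?f n) / 4 ^ n) \<longlonglongrightarrow> 0"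
  proof (rule tendsto_sandwich[OF _ _ tendsto_const zero])
    have "0 \<le> ln (?M n) - ln (?f n) \<and> ln (?M n) - ln (?f n) \<le> ln (16 * \<beta> ^ 4)" if "n \<ge> N" for n
    proof -
      have "ln (?f n) \<le> ln (?M n)"
        using N_DM_bounds(1)[OF tr assms(3), of n] pos[of n] that by simp
      moreover have "ln (?M n) \<le> ln (16 * \<beta> ^ 4 * ?f n)"
        using N_DM_bounds[OF tr assms(3), of n] pos[of n] that
        by (intro ln_mono) auto
      moreover have "ln (16 * \<beta> ^ 4 * ?f n) = ln (16 * \<beta> ^ 4) + ln (?f n)"
        using pos[of n] that assms(3) by (intro ln_mult_pos) auto
      ultimately show ?thesis by simp
    qed
    then show "\<forall>\<^sub>F n in sequentially. 0 \<le> ln (?M n) / 4 ^ n - ln (?f n) / 4 ^ n"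
      "\<forall>\<^sub>F n in sequentially. ln (?M n) / 4 ^ n - ln (?f n) / 4 ^ n \<le> ln (16 * \<beta> ^ 4) * (1 / 4) ^ n"
      by (auto intro!: eventually_sequentiallyI[of N] divide_right_mono
        simp: power_divide simp flip: diff_divide_distrib)
  qed
  from tendsto_add[OF this L(1)] have "(\<lambda>n. ln (?M n) / 4 ^ n) \<longlonglongrightarrow> L"
    by simp
  moreover have "(\<lambda>n. 2 * (1 + 1 * (1 / 4) ^ n)) \<longlonglongrightarrow> 2 * (1 + 0 :: real)"
    by (intro tendsto_intros zero)
  ultimately have "(\<lambda>n. (ln (?M n) / 4 ^ n) / (2 * (1 + 1 * (1 / 4) ^ n))) \<longlonglongrightarrow> L / (2 * (1 + 0))"
    by (rule tendsto_divide) simp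
  moreover have "(ln (?M n) / 4 ^ n) / (2 * (1 + 1 * (1 / 4) ^ n)) =
      ln (?M n) / real (card (sverts 3 n))" for n
    by (simp add: card_sverts_3 field_simps)
  ultimately have "(\<lambda>n. ln (?M n) / real (card (sverts 3 n))) \<longlonglongrightarrow> L / 2"
    by (simp only: add_0_right mult_1_right)
  with L(2,3) show ?thesis
    by (intro exI[of _ "L / 2"]) (simp add: field_simps)
qed

section \<open>Evaluation\<close>

definition pair_sum :: "(nat \<Rightarrow> 'a::comm_semiring_1) \<Rightarrow> nat \<Rightarrow> nat \<Rightarrow> 'a" where
  "pair_sum a x y = a x * a y + a (Suc x) * a y + a x * a (Suc y)"

text \<open>Grouped by which of the two vertices shared by the first copy are covered from the other
  copies. The first copy may cover any of those left, hence the binomial coefficients.\<close>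

definition triangle_sum :: "(nat \<Rightarrow> 'a::comm_semiring_1) \<Rightarrow> nat \<Rightarrow> nat \<Rightarrow> nat \<Rightarrow> 'a" where
  "triangle_sum a x y z = (a x + 2 * a (Suc x) + a (Suc (Suc x))) * pair_sum a y z
     + (a x + a (Suc x)) * (pair_sum a (Suc y) z + pair_sum a y (Suc z))
     + a x * pair_sum a (Suc y) (Suc z)"

text \<open>The same grouping for the three vertices shared by the first copy, with the triangle on
  the other copies.\<close>

definition tetrahedron_sum ::
  "(nat \<Rightarrow> 'a::comm_semiring_1) \<Rightarrow> nat \<Rightarrow> nat \<Rightarrow> nat \<Rightarrow> nat \<Rightarrow> 'a" where
  "tetrahedron_sum a w x y z =
     (a w + 3 * a (Suc w) + 3 * a (Suc (Suc w)) + a (Suc (Suc (Suc w)))) * triangle_sum a x y z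
     + (a w + 2 * a (Suc w) + a (Suc (Suc w)))
       * (triangle_sum a (Suc x) y z + triangle_sum a x (Suc y) z + triangle_sum a x y (Suc z))
     + (a w + a (Suc w))
       * (triangle_sum a (Suc x) (Suc y) z + triangle_sum a (Suc x) y (Suc z)
          + triangle_sum a x (Suc y) (Suc z))
     + a w * triangle_sum a (Suc x) (Suc y) (Suc z)"

lemma mult_3: "3 * x = x + x + (x::'a::comm_semiring_1)"
  by (metis mult_2 numeral_plus_one semiring_norm(5) distrib_right mult_1)

lemma orient_sum_pair:
  "orient_sum {1, 2, 3, 4 :: nat} a [(3, 4)] k = a (k 1) * a (k 2) * pair_sum a (k 3) (k 4)"
  by (simp add: orient_sum.simps bump_def pair_sum_def algebra_simps)

text \<open>Only the pairs at label 2 are unrolled; the remaining pair is replaced by its closed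
  form, which avoids expanding all terms.\<close>

lemma orient_sum_triangle:
  "orient_sum {1, 2, 3, 4 :: nat} a [(2, 3), (2, 4), (3, 4)] k =
    a (k 1) * triangle_sum a (k 2) (k 3) (k 4)"
  by (simp only: orient_sum.simps(2)[where E = "[(3, 4)]"]
      orient_sum.simps(2)[where E = "[(2, 4), (3, 4)]"]
      orient_sum_pair)
    (simp add: bump_def triangle_sum_def mult_2 algebra_simps)

lemma orient_sum_K4:
  "orient_sum {1, 2, 3, 4 :: nat} a K4 k = tetrahedron_sum a (k 1) (k 2) (k 3) (k 4)"
  by (simp only: orient_sum.simps(2)[where E = "[(2, 3), (2, 4), (3, 4)]"]
      orient_sum.simps(2)[where E = "[(1, 4), (2, 3), (2, 4), (3, 4)]"]
      orient_sum.simps(2)[where E = "[(1, 3), (1, 4), (2, 3), (2, 4), (3, 4)]"] orient_sum_triangle)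
    (simp add: bump_def tetrahedron_sum_def mult_2 mult_3 algebra_simps)

lemma pair_sum_commute: "pair_sum a x y = pair_sum a y x"
  by (simp add: pair_sum_def algebra_simps)

text \<open>These two transpositions generate all permutations of the indices.\<close>

lemma triangle_sum_commute:
  "triangle_sum a x y z = triangle_sum a y x z" "triangle_sum a x y z = triangle_sum a x z y"
  by (simp_all add: triangle_sum_def pair_sum_def mult_2 algebra_simps)

text \<open>Subterms are shared to keep the evaluation on large numerals cheap.\<close>

fun count_step ::
  "real \<times> real \<times> real \<times> real \<times> real \<Rightarrow> real \<times> real \<times> real \<times> real \<times> real" where
  "count_step (a0, a1, a2, a3, a4) =
    (let p00 = a0\<^sup>2 + 2 * a0 * a1;
      p01 = a0 * a1 + a1\<^sup>2 + a0 * a2;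
      p02 = a0 * a2 + a1 * a2 + a0 * a3;
      p11 = a1\<^sup>2 + 2 * a1 * a2;
      p12 = a1 * a2 + a2\<^sup>2 + a1 * a3;
      p22 = a2\<^sup>2 + 2 * a2 * a3;
      p23 = a2 * a3 + a3\<^sup>2 + a2 * a4;
      p33 = a3\<^sup>2 + 2 * a3 * a4;
      t000 = (a0 + 2 * a1 + a2) * p00 + (a0 + a1) * (2 * p01) + a0 * p11;
      t001 = (a1 + 2 * a2 + a3) * p00 + (a1 + a2) * (2 * p01) + a1 * p11;
      t011 = (a1 + 2 * a2 + a3) * p01 + (a1 + a2) * (p11 + p02) + a1 * p12;
      t111 = (a1 + 2 * a2 + a3) * p11 + (a1 + a2) * (2 * p12) + a1 * p22;
      t002 = (a2 + 2 * a3 + a4) * p00 + (a2 + a3) * (2 * p01) + a2 * p11;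
      t012 = (a2 + 2 * a3 + a4) * p01 + (a2 + a3) * (p11 + p02) + a2 * p12;
      t112 = (a2 + 2 * a3 + a4) * p11 + (a2 + a3) * (2 * p12) + a2 * p22;
      t022 = (a0 + 2 * a1 + a2) * p22 + (a0 + a1) * (2 * p23) + a0 * p33;
      t122 = (a1 + 2 * a2 + a3) * p22 + (a1 + a2) * (2 * p23) + a1 * p33;
      t222 = (a2 + 2 * a3 + a4) * p22 + (a2 + a3) * (2 * p23) + a2 * p33
     in ((a0 + 3 * a1 + 3 * a2 + a3) * t000 + (a0 + 2 * a1 + a2) * (3 * t001)
       + (a0 + a1) * (3 * t011) + a0 * t111,
      (a1 + 3 * a2 + 3 * a3 + a4) * t000 + (a1 + 2 * a2 + a3) * (3 * t001)
       + (a1 + a2) * (3 * t011) + a1 * t111,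
      (a1 + 3 * a2 + 3 * a3 + a4) * t001 + (a1 + 2 * a2 + a3) * (t002 + 2 * t011)
       + (a1 + a2) * (2 * t012 + t111) + a1 * t112,
      (a1 + 3 * a2 + 3 * a3 + a4) * t011 + (a1 + 2 * a2 + a3) * (2 * t012 + t111)
       + (a1 + a2) * (t022 + 2 * t112) + a1 * t122,
      (a1 + 3 * a2 + 3 * a3 + a4) * t111 + (a1 + 2 * a2 + a3) * (3 * t112)
       + (a1 + a2) * (3 * t122) + a1 * t222))"

text \<open>Each local value \<open>p\<close> or \<open>t\<close> of \<open>count_step\<close> is
  the pair or triangle sum at the indices in its name, up to order; symmetry merges the remaining
  cases.\<close>

lemma count_step_eq:
  "count_step (a 0, a 1, a 2, a 3, a 4) =
    (tetrahedron_sum a 0 0 0 0,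
     tetrahedron_sum a 1 0 0 0,
     tetrahedron_sum a 1 1 0 0,
     tetrahedron_sum a 1 1 1 0,
     tetrahedron_sum a 1 1 1 1)"
proof -
  have S: "Suc 0 = 1" "Suc 1 = 2" "Suc 2 = 3" "Suc 3 = 4"
    by simp_all
  have P: "pair_sum a 1 0 = pair_sum a 0 1" "pair_sum a 2 0 = pair_sum a 0 2"
    "pair_sum a 2 1 = pair_sum a 1 2" "pair_sum a 3 2 = pair_sum a 2 3"
    by (rule pair_sum_commute)+
  have T: "triangle_sum a 0 0 1 = triangle_sum a 1 0 0"
    "triangle_sum a 0 1 0 = triangle_sum a 1 0 0"
    "triangle_sum a 0 1 1 = triangle_sum a 1 0 1"
    "triangle_sum a 1 1 0 = triangle_sum a 1 0 1"
    "triangle_sum a 1 1 2 = triangle_sum a 2 1 1"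
    "triangle_sum a 1 2 0 = triangle_sum a 2 0 1"
    "triangle_sum a 1 2 1 = triangle_sum a 2 1 1"
    "triangle_sum a 2 1 0 = triangle_sum a 2 0 1"
    "triangle_sum a 2 1 2 = triangle_sum a 1 2 2"
    "triangle_sum a 2 2 0 = triangle_sum a 0 2 2"
    "triangle_sum a 2 2 1 = triangle_sum a 1 2 2"
    by (metis triangle_sum_commute)+
  have pair: "(a 0)\<^sup>2 + 2 * a 0 * a 1 = pair_sum a 0 0"
    "a 0 * a 1 + (a 1)\<^sup>2 + a 0 * a 2 = pair_sum a 0 1"
    "a 0 * a 2 + a 1 * a 2 + a 0 * a 3 = pair_sum a 0 2"
    "(a 1)\<^sup>2 + 2 * a 1 * a 2 = pair_sum a 1 1"
    "a 1 * a 2 + (a 2)\<^sup>2 + a 1 * a 3 = pair_sum a 1 2"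
    "(a 2)\<^sup>2 + 2 * a 2 * a 3 = pair_sum a 2 2"
    "a 2 * a 3 + (a 3)\<^sup>2 + a 2 * a 4 = pair_sum a 2 3"
    "(a 3)\<^sup>2 + 2 * a 3 * a 4 = pair_sum a 3 3"
    by (simp_all only: pair_sum_def S power2_eq_square) (simp_all add: algebra_simps)
  have triangle:
    "(a 0 + 2 * a 1 + a 2) * pair_sum a 0 0 + (a 0 + a 1) * (2 * pair_sum a 0 1) + a 0 * pair_sum a 1 1
       = triangle_sum a 0 0 0"
    "(a 1 + 2 * a 2 + a 3) * pair_sum a 0 0 + (a 1 + a 2) * (2 * pair_sum a 0 1) + a 1 * pair_sum a 1 1
       = triangle_sum a 1 0 0"
    "(a 1 + 2 * a 2 + a 3) * pair_sum a 0 1 + (a 1 + a 2) * (pair_sum a 1 1 + pair_sum a 0 2) + a 1 * pair_sum a 1 2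
       = triangle_sum a 1 0 1"
    "(a 1 + 2 * a 2 + a 3) * pair_sum a 1 1 + (a 1 + a 2) * (2 * pair_sum a 1 2) + a 1 * pair_sum a 2 2
       = triangle_sum a 1 1 1"
    "(a 2 + 2 * a 3 + a 4) * pair_sum a 0 0 + (a 2 + a 3) * (2 * pair_sum a 0 1) + a 2 * pair_sum a 1 1
       = triangle_sum a 2 0 0"
    "(a 2 + 2 * a 3 + a 4) * pair_sum a 0 1 + (a 2 + a 3) * (pair_sum a 1 1 + pair_sum a 0 2) + a 2 * pair_sum a 1 2
       = triangle_sum a 2 0 1"
    "(a 2 + 2 * a 3 + a 4) * pair_sum a 1 1 + (a 2 + a 3) * (2 * pair_sum a 1 2) + a 2 * pair_sum a 2 2
       = triangle_sum a 2 1 1"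
    "(a 0 + 2 * a 1 + a 2) * pair_sum a 2 2 + (a 0 + a 1) * (2 * pair_sum a 2 3) + a 0 * pair_sum a 3 3
       = triangle_sum a 0 2 2"
    "(a 1 + 2 * a 2 + a 3) * pair_sum a 2 2 + (a 1 + a 2) * (2 * pair_sum a 2 3) + a 1 * pair_sum a 3 3
       = triangle_sum a 1 2 2"
    "(a 2 + 2 * a 3 + a 4) * pair_sum a 2 2 + (a 2 + a 3) * (2 * pair_sum a 2 3) + a 2 * pair_sum a 3 3
       = triangle_sum a 2 2 2"
    by (simp_all only: triangle_sum_def S P mult_2)
  show ?thesis
    \<comment> \<open>The pair sums are recognised while the bindings are still in place, before
      they are copied into the triangle sums.\<close>
    unfolding count_step.simps pair
    unfolding Let_def triangle tetrahedron_sum_def S T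
    by (simp add: algebra_simps)
qed

definition counts :: "nat \<Rightarrow> real \<times> real \<times> real \<times> real \<times> real" where
  "counts n = (matching_count n 0, matching_count n 1, matching_count n 2, matching_count n 3,
     matching_count n 4)"

lemma counts_0: "counts 0 = (1, 0, 1, 0, 3)"
  by (simp add: counts_def matching_count.simps numeral_3_eq_3 numeral_2_eq_2 numeral_eq_Suc)

lemma counts_Suc: "counts (Suc n) = count_step (counts n)"
proof -
  have "matching_count (Suc n) k = tetrahedron_sum (matching_count n)
      (if 1 \<le> k then 1 else 0) (if 2 \<le> k then 1 else 0) (if 3 \<le> k then 1 else 0)
      (if 4 \<le> k then 1 else 0)" for k
    by (simp add: matching_count.simps labels_3 orient_sum_K4 del: One_nat_def)
  then show ?thesis
    unfolding counts_def count_step_eq by (simp del: One_nat_def)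
qed

lemma counts_4: "counts 4 =
    (50964470212038898478888708725009850524122147811725290619303530540253822838808566443159129779734203368961186541729145374590073046417224638108391065679415989816349274179255091,
     54050395840710970278395783227793477435365220277057089036417827225502794786385875805702084858033114718026014588793601812273082176047203139304674154996165652468365150566677936,
     57323175898479905893154523138809905570915930337228871019317946832322342320514782985155151938002526332969343717328580219040018166506844481617380271855430350216288681400153699,
     60794124519862983867351142783101697042597682315060469225454973676951383848881940013560840602676820128729447685378694146953516645587513231010814544163573174136400432695818488,
     64475240916207043516814833543324643150216657192884143474934717409910615066627948354780783840514677158724614715734477936360151987511524467971457624664933001193228874483382161)"
proof -
  have 1: "counts 1 = (51,
     57,
     62,
     60,
     54)"
    by (simp add: counts_Suc[of 0, unfolded counts_0])
  have 2: "counts 2 =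
    (7365569811,
     7816070424,
     8289450499,
     8786476992,
     9307910577)"
    using counts_Suc[of 1] by (simp add: 1 numeral_2_eq_2 del: One_nat_def)
  have 3: "counts 3 =
    (2724928560954289860903291271266882549492483,
     2889924536764017260444663495693780813791233,
     3064910998294837201844707724238032710560958,
     3250492861272219038243497885127347116333900,
     3447311668153174611916613662896955348826742)"
    using counts_Suc[of 2] by (simp add: 2)
  show ?thesis
    using counts_Suc[of 3] by (simp add: 3)
qed

section \<open>Numerical bounds for the exponential function\<close>

lemma exp_bounds:
  fixes x :: real
  assumes "0 \<le> x" "x \<le> 1"
  shows "(\<Sum>m<n. x ^ m / fact m) \<le> exp x" "exp x \<le> (\<Sum>m<n. x ^ m / fact m) + 3 / fact n * x ^ n"
proof -
  obtain t where t: "\<bar>t\<bar> \<le> \<bar>x\<bar>" "exp x = (\<Sum>m<n. x ^ m / fact m) + exp t / fact n * x ^ n"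
    using Maclaurin_exp_le by blast
  have "exp t \<le> exp 1"
    using t(1) assms by simp
  then have "exp t \<le> 3"
    using exp_le by (rule order_trans)
  then have "exp t / fact n * x ^ n \<le> 3 / fact n * x ^ n"
    using assms by (intro mult_right_mono divide_right_mono) auto
  with t(2) show "exp x \<le> (\<Sum>m<n. x ^ m / fact m) + 3 / fact n * x ^ n"
    by simp
  show "(\<Sum>m<n. x ^ m / fact m) \<le> exp x"
    using assms by (simp add: t(2))
qed

text \<open>One squaring step: \<open>v\<close> leaves room for rounding \<open>u ^ 2\<close> up,
  and the separate premise on \<open>y\<close> allows both arguments to be decimal literals.\<close>

lemma exp_double_le:
  fixes x :: real
  assumes "exp x \<le> u" "u ^ 2 \<le> v" "y = 2 * x"
  shows "exp y \<le> v"
  using power_mono[OF assms(1), of 2] assms(2,3) by (simp add: exp_double)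

lemma exp_double_ge:
  fixes x :: real
  assumes "u \<le> exp x" "0 \<le> u" "v \<le> u ^ 2" "y = 2 * x"
  shows "v \<le> exp y"
  using power_mono[OF assms(1,2), of 2] assms(3,4) by (simp add: exp_double)

text \<open>To bound \<open>exp (512 z)\<close>: Taylor's formula at \<open>z / 16\<close>, then 13 squarings, each rounded in the safe
  direction.\<close>

lemma exp_512_le: "exp (512 * 0.781151467411 :: real) \<le> 496458756944178398354482000000000000000000000000000000000000000000000000000000000000000000000000000000000000000000000000000000000000000000000000000000000000000000000000000000"
proof -
  have "exp (0.0488219667131875::real) \<le> 1.05003339320193484012065"
    by (rule order_trans[OF exp_bounds(2)[where n = 11]])
      (simp_all add: lessThan_nat_numeral fact_numeral power_divide)
  then have "exp (0.097643933426375::real) \<le> 1.10257012683916909971438"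
    by (rule exp_double_le) (simp_all add: power2_eq_square)
  then have "exp (0.19528786685275::real) \<le> 1.21566088459814143671899"
    by (rule exp_double_le) (simp_all add: power2_eq_square)
  then have "exp (0.3905757337055::real) \<le> 1.47783138634193575179545"
    by (rule exp_double_le) (simp_all add: power2_eq_square)
  then have "exp (0.781151467411::real) \<le> 2.18398560645732776811457"
    by (rule exp_double_le) (simp_all add: power2_eq_square)
  then have "exp (1.562302934822::real) \<le> 4.76979312921278176178181"
    by (rule exp_double_le) (simp_all add: power2_eq_square)
  then have "exp (3.124605869644::real) \<le> 22.7509264954854606116921"
    by (rule exp_double_le) (simp_all add: power2_eq_square)
  then have "exp (6.249211739288::real) \<le> 517.604656402982342410886"
    by (rule exp_double_le) (simp_all add: power2_eq_square)
  then have "exp (12.498423478576::real) \<le> 267914.580330049409597717"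
    by (rule exp_double_le) (simp_all add: power2_eq_square)
  then have "exp (24.996846957152::real) \<le> 71778222353.4264980121733"
    by (rule exp_double_le) (simp_all add: power2_eq_square)
  then have "exp (49.993693914304::real) \<le> 5152113204217935394910.96"
    by (rule exp_double_le) (simp_all add: power2_eq_square)
  then have "exp (99.987387828608::real) \<le> 26544270469076801267527000000000000000000000"
    by (rule exp_double_le) (simp_all add: power2_eq_square)
  then have "exp (199.974775657216::real) \<le> 704598294735502747196204000000000000000000000000000000000000000000000000000000000000000"
    by (rule exp_double_le) (simp_all add: power2_eq_square)
  then have "exp (399.949551314432::real) \<le> 496458756944178398354482000000000000000000000000000000000000000000000000000000000000000000000000000000000000000000000000000000000000000000000000000000000000000000000000000000"
    by (rule exp_double_le) (simp_all add: power2_eq_square)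
  then show ?thesis by simp
qed

lemma exp_512_ge: "496458757198365280809443000000000000000000000000000000000000000000000000000000000000000000000000000000000000000000000000000000000000000000000000000000000000000000000000000000 \<le> exp (512 * 0.781151467412 :: real)"
proof -
  have "1.05003339320200046720743 \<le> exp (0.04882196671325::real)"
    by (rule order_trans[OF _ exp_bounds(1)[where n = 11]])
      (simp_all add: lessThan_nat_numeral fact_numeral power_divide)
  then have "1.10257012683930692097961 \<le> exp (0.0976439334265::real)"
    by (rule exp_double_ge) (simp_all add: power2_eq_square)
  then have "1.21566088459844535193875 \<le> exp (0.195287866853::real)"
    by (rule exp_double_ge) (simp_all add: power2_eq_square)
  then have "1.47783138634267466748524 \<le> exp (0.390575733706::real)"
    by (rule exp_double_ge) (simp_all add: power2_eq_square)
  then have "2.18398560645951175371102 \<le> exp (0.781151467412::real)"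
    by (rule exp_double_ge) (simp_all add: power2_eq_square)
  then have "4.76979312922232134799652 \<le> exp (1.562302934824::real)"
    by (rule exp_double_ge) (simp_all add: power2_eq_square)
  then have "22.7509264955764643172570 \<le> exp (3.124605869648::real)"
    by (rule exp_double_ge) (simp_all add: power2_eq_square)
  then have "517.604656407123179643141 \<le> exp (6.249211739296::real)"
    by (rule exp_double_ge) (simp_all add: power2_eq_square)
  then have "267914.580334336042863377 \<le> exp (12.498423478592::real)"
    by (rule exp_double_ge) (simp_all add: power2_eq_square)
  then have "71778222355.7234011169878 \<le> exp (24.996846957184::real)"
    by (rule exp_double_ge) (simp_all add: power2_eq_square)
  then have "5152113204547670638479.53 \<le> exp (49.993693914368::real)"
    by (rule exp_double_ge) (simp_all add: power2_eq_square)
  then have "26544270472474467872206900000000000000000000 \<le> exp (99.987387828736::real)"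
    by (rule exp_double_ge) (simp_all add: power2_eq_square)
  then have "704598294915879909844493000000000000000000000000000000000000000000000000000000000000000 \<le> exp (199.974775657472::real)"
    by (rule exp_double_ge) (simp_all add: power2_eq_square)
  then have "496458757198365280809443000000000000000000000000000000000000000000000000000000000000000000000000000000000000000000000000000000000000000000000000000000000000000000000000000000 \<le> exp (399.949551314944::real)"
    by (rule exp_double_ge) (simp_all add: power2_eq_square)
  then show ?thesis by simp
qed

theorem propositionV1:
  shows "\<exists>z::real.
    (\<lambda>n. ln (real (N_DM (sierpinski 3 n))) / real (card (verts (sierpinski 3 n))))
      \<longlonglongrightarrow> z
    \<and> 0.781151467411 \<le> z \<and> z < 0.781151467412"
proof -
  \<comment> \<open>These decimals enclose all four ratios at stage 4. Their gap of
    \<open>10 ^ -11\<close> moves the bounds on \<open>z\<close> by less than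
    \<open>10 ^ -13\<close>.\<close>
  let ?\<alpha> = "1.06055052894 :: real" and ?\<beta> = "1.06055052895 :: real"
  note c = counts_4[unfolded counts_def prod.inject]
  have "trapped ?\<alpha> ?\<beta> 4"
    unfolding trapped_def
  proof (intro allI impI)
    fix k :: nat assume "k < 4"
    then consider "k = 0" | "k = 1" | "k = 2" | "k = 3" by linarith
    then show "?\<alpha> * matching_count 4 k \<le> matching_count 4 (Suc k) \<and>
      matching_count 4 (Suc k) \<le> ?\<beta> * matching_count 4 k"
      by cases (use c in \<open>simp_all add: eval_nat_numeral\<close>)
  qed
  then obtain z where z: "(\<lambda>n. ln (real (N_DM (sierpinski 3 n))) / real (card (sverts 3 n))) \<longlonglongrightarrow> z"
    "(ln (matching_count 4 0) + 2 * ln (1 + 2 * ?\<alpha>)) / (2 * 4 ^ 4) \<le> z"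
    "z \<le> (ln (matching_count 4 0) + 2 * ln (1 + 2 * ?\<beta>)) / (2 * 4 ^ 4)"
    using growth_constant[of ?\<alpha> ?\<beta> 4] c(1) by auto
  have ln_eq: "ln (matching_count 4 0) + 2 * ln x = ln (matching_count 4 0 * x ^ 2)" if "0 < x" for x
    using that c by (simp add: ln_mult ln_realpow)
  \<comment> \<open>Here \<open>512 = 2 * 4 ^ 4\<close>. Exponentiating turns the bound on
    \<open>z\<close> into a comparison of explicit rational numbers with exponentials, so no
    logarithm has to be evaluated.\<close>
  have "exp (512 * 0.781151467411) \<le> matching_count 4 0 * (1 + 2 * ?\<alpha>) ^ 2"
    by (rule order_trans[OF exp_512_le]) (simp add: c(1) power2_eq_square)
  then have "512 * 0.781151467411 \<le> ln (matching_count 4 0 * (1 + 2 * ?\<alpha>) ^ 2)"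
    using c(1) by (subst ln_ge_iff) auto
  then have "0.781151467411 \<le> z"
    using z(2) ln_eq[of "1 + 2 * ?\<alpha>"] by simp
  have "matching_count 4 0 * (1 + 2 * ?\<beta>) ^ 2 < exp (512 * 0.781151467412)"
    by (rule less_le_trans[OF _ exp_512_ge]) (simp add: c(1) power2_eq_square)
  then have "ln (matching_count 4 0 * (1 + 2 * ?\<beta>) ^ 2) < 512 * 0.781151467412"
    using c(1) ln_less_cancel_iff[of "matching_count 4 0 * (1 + 2 * ?\<beta>) ^ 2" "exp (512 * 0.781151467412)"]
    by simp
  then have "z < 0.781151467412"
    using z(3) ln_eq[of "1 + 2 * ?\<beta>"] by simp
  with z(1) \<open>0.781151467411 \<le> z\<close> show ?thesis by blast
qed

end
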